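(* There exists a constant $C>0$ such that $$R_{\mathrm{ind}}(H;r)\le r^{Crk}$$ for every integer $r\ge 2$ and every graph $H$ on $k$ vertices.
   Context: For a graph $H$ and an integer $r\ge 1$, the $r$-colour induced Ramsey number $R_{\mathrm{ind}}(H;r)$ is the minimum number of vertices of a graph $G$ such that every colouring $c:E(G)\to[r]=\{1,\dots,r\}$ of the edges of $G$ admits a set $L\subset V(G)$ with $G[L]\cong H$ (an induced copy of $H$ in $G$) all of whose edges receive the same colour under $c$. *)

theory Defs
  imports Main "HOL-Analysis.Analysis"
begin

text \<open>A (simple) graph on vertex set {0..<n}: symmetric irreflexive adjacency relation
  (only its values on {0..<n} matter).\<close>
definition is_graph :: "nat \<Rightarrow> (nat \<Rightarrow> nat \<Rightarrow> bool) \<Rightarrow> bool" where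
  "is_graph n E \<longleftrightarrow> (\<forall>u<n. \<forall>v<n. E u v \<longleftrightarrow> E v u) \<and> (\<forall>u<n. \<not> E u u)"

definition induced_embedding ::
  "nat \<Rightarrow> (nat \<Rightarrow> nat \<Rightarrow> bool) \<Rightarrow> nat \<Rightarrow> (nat \<Rightarrow> nat \<Rightarrow> bool) \<Rightarrow> (nat \<Rightarrow> nat) \<Rightarrow> bool" where
  "induced_embedding k H n G f \<longleftrightarrow>
     inj_on f {0..<k} \<and> f ` {0..<k} \<subseteq> {0..<n} \<and>
     (\<forall>u<k. \<forall>v<k. H u v \<longleftrightarrow> G (f u) (f v))"

definition ind_arrows ::
  "nat \<Rightarrow> (nat \<Rightarrow> nat \<Rightarrow> bool) \<Rightarrow> nat \<Rightarrow> nat \<Rightarrow> (nat \<Rightarrow> nat \<Rightarrow> bool) \<Rightarrow> bool" where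
  "ind_arrows n G r k H \<longleftrightarrow>
     (\<forall>c :: nat set \<Rightarrow> nat.
        (\<forall>u<n. \<forall>v<n. G u v \<longrightarrow> c {u, v} \<in> {1..r}) \<longrightarrow>
        (\<exists>f col. induced_embedding k H n G f \<and>
           (\<forall>u<k. \<forall>v<k. H u v \<longrightarrow> c {f u, f v} = col)))"

definition R_ind :: "nat \<Rightarrow> (nat \<Rightarrow> nat \<Rightarrow> bool) \<Rightarrow> nat \<Rightarrow> nat" where
  "R_ind k H r = (LEAST n. \<exists>G. is_graph n G \<and> ind_arrows n G r k H)"

end

theory Submission
  imports Defs
begin

text \<open>The host is the inner product graph on the subsets of a \<open>d\<close>-element set (distinct sets are
  adjacent iff their intersection has odd size). By Lindsey's inequality, between any two vertex sets of
  size \<open>4 \<surd>n\<close>, at least a quarter of the pairs are edges and at least a quarter are non-edges.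

  Given a colouring, try to build a copy of \<open>H\<close> in every colour simultaneously. A state consists of
  a set \<open>U\<close> of slots (vertex \<open>u\<close> of the copy in colour \<open>c\<close>) and a set \<open>E\<close> of pairs of slots of one copy
  that are not adjacent in \<open>H\<close>. Count the tuples of \<open>2rk\<close> host vertices in which the first \<open>|U|\<close> fill
  the slots and the others form a core, joined to each slot in the colour of that slot; edges of \<open>H\<close>
  inside a copy must be edges of the right colour, whereas non-edges are enforced only for the pairs
  in \<open>E\<close>. Multiply the count by \<open>(8r)^(2rk)\<close> for each slot and by \<open>8\<close> for each pair in \<open>E\<close>, and take a
  state of maximal weight. Three comparisons finish the proof.

  \<^item> As in the Erdos-Szekeres argument, a core vertex can be promoted to a slot in one of the
    colours, losing a factor less than \<open>(8r)^(2rk)\<close>. Hence some copy has all its slots.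

  \<^item> Deleting a slot does not increase the weight. Hence in most tuples, each single slot can be
    refilled in at least \<open>4 \<surd>n\<close> ways when everything else is kept.

  \<^item> Two slots that are not adjacent in \<open>H\<close> and not paired in \<open>E\<close> can be refilled independently of each
    other, so by the pseudorandomness of the host about a quarter of the refillings are
    non-edges, and the pair could be added to \<open>E\<close> with a gain. Hence \<open>E\<close> contains all such pairs.\<close>

section \<open>Counting lemmas\<close>

text \<open>Jensen's inequality for the convex function \<open>x ^ Suc q\<close> on the nonnegative
  reals.\<close>

lemma power_sum_le_card_mult_sum_power:
  fixes a :: "'a \<Rightarrow> real"
  assumes "finite S" "\<And>i. i \<in> S \<Longrightarrow> 0 \<le> a i"
  shows "(\<Sum>i\<in>S. a i) ^ Suc q \<le> real (card S) ^ q * (\<Sum>i\<in>S. a i ^ Suc q)"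
proof (cases "S = {}")
  case False
  let ?N = "real (card S)"
  have N: "?N > 0" using False assms(1) by (simp add: card_gt_0_iff)
  have cv: "convex_on {0..} (\<lambda>x::real. x ^ Suc q)"
    using convex_power_even[of "Suc q"] convex_power_odd[of "Suc q"]
    by (cases "even (Suc q)") (auto intro: convex_on_subset)
  have "(\<Sum>i\<in>S. (1 / ?N) *\<^sub>R a i) ^ Suc q \<le> (\<Sum>i\<in>S. (1 / ?N) * a i ^ Suc q)"
    by (rule convex_on_sum[OF assms(1) False cv]) (use assms N in auto)
  then have "(\<Sum>i\<in>S. a i) ^ Suc q / ?N ^ Suc q \<le> (\<Sum>i\<in>S. a i ^ Suc q) / ?N"
    by (simp add: sum_divide_distrib[symmetric] power_divide)
  then show ?thesis using N by (simp add: field_simps)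
qed simp

text \<open>Group the pairs by what remains when coordinate \<open>i\<close> is overwritten with
  \<open>undefined\<close>. A class is a single fibre, so a class that contains a counted pair has
  fewer than \<open>s\<close> elements.\<close>

lemma card_small_fibres_le:
  fixes Z :: "(('i \<Rightarrow> 'v) \<times> 'y) set"
  assumes fin: "finite Z"
  shows "card {(x, y) \<in> Z. card {a. (x(i := a), y) \<in> Z} < s}
    \<le> s * card ((\<lambda>(x, y). (x(i := undefined), y)) ` Z)"
proof -
  let ?\<rho> = "\<lambda>(x, y). (x(i := undefined), y) :: ('i \<Rightarrow> 'v) \<times> 'y"
  let ?S = "{(x, y) \<in> Z. card {a. (x(i := a), y) \<in> Z} < s}"
  have finS: "finite ?S" by (rule finite_subset[OF _ fin]) auto
  have "card ?S = (\<Sum>t \<in> ?\<rho> ` ?S. card {z \<in> ?S. ?\<rho> z = t})"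
    using sum.image_gen[OF finS, of "\<lambda>_. 1::nat" ?\<rho>] by simp
  also have "\<dots> \<le> (\<Sum>t \<in> ?\<rho> ` ?S. s)"
  proof (rule sum_mono)
    fix t assume "t \<in> ?\<rho> ` ?S"
    then obtain x0 y0 where z0: "(x0, y0) \<in> Z" "card {a. (x0(i := a), y0) \<in> Z} < s"
      and t: "t = (x0(i := undefined), y0)" by auto
    let ?F = "{a. (x0(i := a), y0) \<in> Z}"
    have finF: "finite ?F"
    proof (rule finite_subset)
      show "?F \<subseteq> (\<lambda>(x, y). x i) ` Z" by (force simp: image_iff)
    qed (use fin in simp)
    have "{z \<in> ?S. ?\<rho> z = t} \<subseteq> (\<lambda>a. (x0(i := a), y0)) ` ?F"
    proof
      fix z assume "z \<in> {z \<in> ?S. ?\<rho> z = t}"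
      then obtain x where x: "z = (x, y0)" "(x, y0) \<in> Z" and eq: "x(i := undefined) = x0(i := undefined)"
        unfolding t by auto
      have "x = x0(i := x i)"
      proof
        fix j show "x j = (x0(i := x i)) j" using fun_cong[OF eq, of j] by (auto split: if_splits)
      qed
      then show "z \<in> (\<lambda>a. (x0(i := a), y0)) ` ?F" using x by (intro image_eqI[of _ _ "x i"]) auto
    qed
    then have "card {z \<in> ?S. ?\<rho> z = t} \<le> card ?F"
      by (rule surj_card_le[OF finF])
    then show "card {z \<in> ?S. ?\<rho> z = t} \<le> s" using z0 by simp
  qed
  also have "\<dots> \<le> s * card (?\<rho> ` Z)"
  proof -
    have "card (?\<rho> ` ?S) \<le> card (?\<rho> ` Z)" by (rule card_mono) (use fin in auto)
    then show ?thesis by simp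
  qed
  finally show ?thesis .
qed

text \<open>The exchange hypotheses say that, once all other coordinates are fixed, the admissible values of
  \<open>(x i, x l)\<close> form a product set.\<close>

lemma card_large_fibres_le:
  fixes Z :: "(('i \<Rightarrow> 'v) \<times> 'y) set"
  assumes fin: "finite Z" and ne: "i \<noteq> l"
    and exi: "\<And>x x' y. (x, y) \<in> Z \<Longrightarrow> (x', y) \<in> Z \<Longrightarrow> (\<And>j. j \<noteq> i \<Longrightarrow> j \<noteq> l \<Longrightarrow> x j = x' j)
      \<Longrightarrow> (x(i := x' i), y) \<in> Z"
    and exl: "\<And>x x' y. (x, y) \<in> Z \<Longrightarrow> (x', y) \<in> Z \<Longrightarrow> (\<And>j. j \<noteq> i \<Longrightarrow> j \<noteq> l \<Longrightarrow> x j = x' j)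
      \<Longrightarrow> (x(l := x' l), y) \<in> Z"
    and V: "\<And>x y. (x, y) \<in> Z \<Longrightarrow> x i \<in> V \<and> x l \<in> V" and finV: "finite V"
    and P: "\<And>A B. A \<subseteq> V \<Longrightarrow> B \<subseteq> V \<Longrightarrow> s \<le> card A \<Longrightarrow> s \<le> card B \<Longrightarrow>
      card A * card B \<le> 4 * card {(a, b) \<in> A \<times> B. P a b}"
  shows "card {(x, y) \<in> Z. s \<le> card {a. (x(i := a), y) \<in> Z} \<and> s \<le> card {b. (x(l := b), y) \<in> Z}}
    \<le> 4 * card {(x, y) \<in> Z. P (x i) (x l)}"
proof -
  let ?\<rho> = "\<lambda>(x, y). (x(i := undefined, l := undefined), y) :: ('i \<Rightarrow> 'v) \<times> 'y"
  let ?S = "{(x, y) \<in> Z. s \<le> card {a. (x(i := a), y) \<in> Z} \<and> s \<le> card {b. (x(l := b), y) \<in> Z}}"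
  let ?Q = "{(x, y) \<in> Z. P (x i) (x l)}"
  have finS: "finite ?S" and finQ: "finite ?Q" by (rule finite_subset[OF _ fin]; auto)+
  have "card ?S = (\<Sum>t \<in> ?\<rho> ` ?S. card {z \<in> ?S. ?\<rho> z = t})"
    using sum.image_gen[OF finS, of "\<lambda>_. 1::nat" ?\<rho>] by simp
  also have "\<dots> \<le> (\<Sum>t \<in> ?\<rho> ` ?S. 4 * card {z \<in> ?Q. ?\<rho> z = t})"
  proof (rule sum_mono)
    fix t assume "t \<in> ?\<rho> ` ?S"
    then obtain x0 y0 where z0: "(x0, y0) \<in> Z" and t: "t = (x0(i := undefined, l := undefined), y0)"
      and s: "s \<le> card {a. (x0(i := a), y0) \<in> Z}" "s \<le> card {b. (x0(l := b), y0) \<in> Z}" by auto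
    define A where "A = {a. (x0(i := a), y0) \<in> Z}"
    define B where "B = {b. (x0(l := b), y0) \<in> Z}"
    let ?f = "\<lambda>(a, b). (x0(i := a, l := b), y0)"
    have AV: "A \<subseteq> V" using V by (fastforce simp: A_def)
    have BV: "B \<subseteq> V" using V by (fastforce simp: B_def)
    have fAB: "finite (A \<times> B)" using AV BV finV finite_subset by blast
    \<comment> \<open>The class with coordinates \<open>i\<close> and \<open>l\<close> erased is a
      copy of \<open>A \<times> B\<close>: the exchange hypotheses give one inclusion here and the
      other in \<open>inZ\<close>.\<close>
    have cls: "\<exists>a b. z = ?f (a, b) \<and> a \<in> A \<and> b \<in> B" if "z \<in> Z" "?\<rho> z = t" for z
    proof -
      obtain x y where xy: "z = (x, y)" by (cases z)
      have y: "y = y0" and eq: "x(i := undefined, l := undefined) = x0(i := undefined, l := undefined)"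
        using that(2) unfolding t xy by simp_all
      have z: "z = (x, y0)" "(x, y0) \<in> Z" using that(1) xy y by simp_all
      have agree: "x j = x0 j" if "j \<noteq> i" "j \<noteq> l" for j
        using fun_cong[OF eq, of j] that by auto
      have "x = x0(i := x i, l := x l)" by (rule ext) (simp add: agree)
      moreover have "x i \<in> A" using exi[OF z0 z(2)] agree by (simp add: A_def)
      moreover have "x l \<in> B" using exl[OF z0 z(2)] agree by (simp add: B_def)
      ultimately show ?thesis using z(1) by auto
    qed
    have inZ: "?f (a, b) \<in> Z" if "a \<in> A" "b \<in> B" for a b
    proof -
      have "((x0(i := a))(l := (x0(l := b)) l), y0) \<in> Z"
        by (rule exl[of "x0(i := a)" y0 "x0(l := b)"]) (use that in \<open>auto simp: A_def B_def\<close>)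
      then show ?thesis by simp
    qed
    have "{z \<in> ?S. ?\<rho> z = t} \<subseteq> ?f ` (A \<times> B)"
    proof
      fix z assume "z \<in> {z \<in> ?S. ?\<rho> z = t}"
      then have "z \<in> Z" "?\<rho> z = t" by auto
      from cls[OF this] show "z \<in> ?f ` (A \<times> B)" by blast
    qed
    from surj_card_le[OF fAB this] have 1: "card {z \<in> ?S. ?\<rho> z = t} \<le> card A * card B"
      by (simp only: card_cartesian_product)
    have 2: "card A * card B \<le> 4 * card {(a, b) \<in> A \<times> B. P a b}"
      using P[OF AV BV] s by (simp add: A_def B_def)
    have 3: "card {(a, b) \<in> A \<times> B. P a b} = card (?f ` {(a, b) \<in> A \<times> B. P a b})"
    proof (rule card_image[symmetric], rule inj_onI)
      fix p q assume "?f p = ?f q"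
      then have "x0(i := fst p, l := snd p) = x0(i := fst q, l := snd q)"
        by (simp only: case_prod_unfold prod.inject)
      from fun_cong[OF this, of i] fun_cong[OF this, of l] show "p = q"
        using ne by (simp add: prod_eq_iff)
    qed
    have 4: "card (?f ` {(a, b) \<in> A \<times> B. P a b}) \<le> card {z \<in> ?Q. ?\<rho> z = t}"
    proof (rule card_mono)
      show "finite {z \<in> ?Q. ?\<rho> z = t}" using finQ by simp
      show "?f ` {(a, b) \<in> A \<times> B. P a b} \<subseteq> {z \<in> ?Q. ?\<rho> z = t}"
      proof
        fix z assume "z \<in> ?f ` {(a, b) \<in> A \<times> B. P a b}"
        then obtain a b where ab: "a \<in> A" "b \<in> B" "P a b" and z: "z = (x0(i := a, l := b), y0)"
          by (auto simp only: case_prod_unfold)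
        have "(x0(i := a, l := b))(i := undefined, l := undefined) = x0(i := undefined, l := undefined)"
          by (rule ext) simp
        then show "z \<in> {z \<in> ?Q. ?\<rho> z = t}"
          using inZ[OF ab(1,2)] ab(3) ne unfolding t z by simp
      qed
    qed
    from 1 2 3 4 show "card {z \<in> ?S. ?\<rho> z = t} \<le> 4 * card {z \<in> ?Q. ?\<rho> z = t}" by linarith
  qed
  also have "\<dots> = 4 * (\<Sum>t \<in> ?\<rho> ` ?S. card {z \<in> ?Q. ?\<rho> z = t})"
    by (rule sum_distrib_left[symmetric])
  finally have 5: "card ?S \<le> 4 * (\<Sum>t \<in> ?\<rho> ` ?S. card {z \<in> ?Q. ?\<rho> z = t})" .
  \<comment> \<open>Classes that meet \<open>?Q\<close> but not \<open>?S\<close> only enlarge the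
    sum, and classes that miss \<open>?Q\<close> contribute 0.\<close>
  have "(\<Sum>t \<in> ?\<rho> ` ?S. card {z \<in> ?Q. ?\<rho> z = t}) \<le> (\<Sum>t \<in> ?\<rho> ` ?S \<union> ?\<rho> ` ?Q. card {z \<in> ?Q. ?\<rho> z = t})"
    by (rule sum_mono2) (use finS finQ in auto)
  also have "\<dots> = (\<Sum>t \<in> ?\<rho> ` ?Q. card {z \<in> ?Q. ?\<rho> z = t})"
  proof (rule sum.mono_neutral_right)
    show "\<forall>t \<in> ?\<rho> ` ?S \<union> ?\<rho> ` ?Q - ?\<rho> ` ?Q. card {z \<in> ?Q. ?\<rho> z = t} = 0"
    proof
      fix t assume "t \<in> ?\<rho> ` ?S \<union> ?\<rho> ` ?Q - ?\<rho> ` ?Q"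
      then have "{z \<in> ?Q. ?\<rho> z = t} = {}" by blast
      then show "card {z \<in> ?Q. ?\<rho> z = t} = 0" by (simp only: card.empty)
    qed
  qed (use finS finQ in auto)
  also have "\<dots> = card ?Q"
    using sum.image_gen[OF finQ, of "\<lambda>_. 1::nat" ?\<rho>] by simp
  finally show ?thesis using 5 by linarith
qed

section \<open>The inner product graph\<close>

text \<open>The entries of the Sylvester-Hadamard matrix, with rows and columns indexed by
  sets.\<close>

definition inner_sign :: "'a set \<Rightarrow> 'a set \<Rightarrow> real" where
  "inner_sign a b = (- 1) ^ card (a \<inter> b)"

lemma inner_sign_eq_prod:
  assumes "finite b"
  shows "inner_sign a b = (\<Prod>i\<in>b. if i \<in> a then - 1 else 1)"
proof -
  have "(\<Prod>i\<in>b. if i \<in> a then - 1 else 1) = (\<Prod>i\<in>b \<inter> a. - 1 :: real)"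
    using assms by (simp add: prod.If_cases Int_def)
  then show ?thesis by (simp add: inner_sign_def Int_commute)
qed

text \<open>Orthogonality of the rows. The summand is multiplicative in \<open>z\<close>, so the sum
  over all subsets factorises over the points of \<open>D\<close>; a point lying in just one of
  \<open>a\<close> and \<open>b\<close> gives the factor 0.\<close>

lemma sum_inner_sign_mult:
  assumes D: "finite D" and "a \<subseteq> D" "b \<subseteq> D"
  shows "(\<Sum>z\<in>Pow D. inner_sign a z * inner_sign b z) = (if a = b then 2 ^ card D else 0)"
proof -
  let ?f = "\<lambda>i. (if i \<in> a then - 1 else 1) * (if i \<in> b then - 1 else 1 :: real)"
  have "(\<Sum>z\<in>Pow D. inner_sign a z * inner_sign b z) = (\<Sum>z\<in>Pow D. \<Prod>i\<in>z. ?f i)"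
    by (rule sum.cong) (auto simp: inner_sign_eq_prod prod.distrib finite_subset[OF _ D])
  also have "\<dots> = (\<Prod>i\<in>D. ?f i + 1)"
    by (simp add: prod_add[OF D])
  also have "\<dots> = (if a = b then 2 ^ card D else 0)"
  proof (cases "a = b")
    case True
    then have "(\<Prod>i\<in>D. ?f i + 1) = (\<Prod>i\<in>D. 2)" by (intro prod.cong) auto
    then show ?thesis using True by simp
  next
    case False
    then obtain i where "i \<in> D" "(i \<in> a) \<noteq> (i \<in> b)" using assms by blast
    then have "\<exists>i\<in>D. ?f i + 1 = 0" by (intro bexI[of _ i]) auto
    then show ?thesis using False D by (simp add: prod_zero_iff)
  qed
  finally show ?thesis .
qed

text \<open>Lindsey's inequality.\<close>

lemma inner_sign_sum_squared_le:
  assumes D: "finite D" and A: "A \<subseteq> Pow D" and B: "B \<subseteq> Pow D"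
  shows "(\<Sum>a\<in>A. \<Sum>b\<in>B. inner_sign a b)\<^sup>2 \<le> 2 ^ card D * real (card A) * real (card B)"
proof -
  have fP: "finite (Pow D)" using D by simp
  note fA = finite_subset[OF A fP] and fB = finite_subset[OF B fP]
  have comm: "inner_sign a b = inner_sign b a" for a b by (simp add: inner_sign_def Int_commute)
  have "(\<Sum>a\<in>A. \<Sum>b\<in>B. inner_sign a b)\<^sup>2 \<le> (\<Sum>a\<in>A. (\<Sum>b\<in>B. inner_sign a b)\<^sup>2) * real (card A)"
    by (rule sum_squared_le_sum_of_squares)
  \<comment> \<open>The outer sum is extended to all rows so that orthogonality removes every term
    with \<open>b \<noteq> b'\<close>.\<close>
  also have "\<dots> \<le> (\<Sum>a\<in>Pow D. (\<Sum>b\<in>B. inner_sign a b)\<^sup>2) * real (card A)"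
    by (intro mult_right_mono sum_mono2) (use A fP in auto)
  also have "(\<Sum>a\<in>Pow D. (\<Sum>b\<in>B. inner_sign a b)\<^sup>2)
      = (\<Sum>a\<in>Pow D. \<Sum>b\<in>B. \<Sum>b'\<in>B. inner_sign b a * inner_sign b' a)"
    by (simp add: power2_eq_square sum_product comm)
  also have "\<dots> = (\<Sum>b\<in>B. \<Sum>b'\<in>B. \<Sum>a\<in>Pow D. inner_sign b a * inner_sign b' a)"
    by (subst sum.swap) (rule sum.cong[OF refl], rule sum.swap)
  also have "\<dots> = (\<Sum>b\<in>B. \<Sum>b'\<in>B. if b = b' then 2 ^ card D else 0)"
    by (intro sum.cong refl sum_inner_sign_mult[OF D]) (use B in auto)
  also have "\<dots> = real (card B) * 2 ^ card D"
    using fB by simp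
  finally show ?thesis by (simp add: mult_ac)
qed

text \<open>As \<open>card A * card B\<close> is at least 16 times the number \<open>m ^ 4\<close>
  of vertices, Lindsey's inequality bounds the difference between even and odd pairs by a quarter of
  all pairs. Each parity thus has at least 3/8 of them, and discarding the diagonal costs at most
  1/8.\<close>

lemma inner_product_graph_balanced:
  assumes D: "finite D" and card_D: "2 ^ card D = m ^ 4" and m: "2 \<le> m"
    and A: "A \<subseteq> Pow D" and B: "B \<subseteq> Pow D" and sA: "4 * m\<^sup>2 \<le> card A" and sB: "4 * m\<^sup>2 \<le> card B"
  shows "card A * card B \<le> 4 * card {(a, b) \<in> A \<times> B. a \<noteq> b \<and> odd (card (a \<inter> b))}" (is ?thesis1)
    and "card A * card B \<le> 4 * card {(a, b) \<in> A \<times> B. a \<noteq> b \<and> even (card (a \<inter> b))}" (is ?thesis2)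
proof -
  have fP: "finite (Pow D)" using D by simp
  note fA = finite_subset[OF A fP] and fB = finite_subset[OF B fP]
  let ?odd = "{(a, b) \<in> A \<times> B. odd (card (a \<inter> b))}"
  let ?even = "{(a, b) \<in> A \<times> B. even (card (a \<inter> b))}"
  have fin: "finite ?odd" "finite ?even" by (rule finite_subset[of _ "A \<times> B"]; use fA fB in auto)+
  let ?S = "\<Sum>a\<in>A. \<Sum>b\<in>B. inner_sign a b"
  have split: "A \<times> B = ?odd \<union> ?even" by auto
  have "card A * card B = card (A \<times> B)" by (simp add: card_cartesian_product)
  also have "\<dots> = card ?odd + card ?even"
    by (subst split, rule card_Un_disjoint) (use fin in auto)
  finally have "real (card A * card B) = real (card ?odd + card ?even)" by (simp only:)
  then have total: "real (card A) * real (card B) = real (card ?odd) + real (card ?even)"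
    by (simp only: of_nat_mult of_nat_add)
  have "?S = (\<Sum>p\<in>A \<times> B. inner_sign (fst p) (snd p))" by (simp add: sum.cartesian_product case_prod_unfold)
  also have "\<dots> = (\<Sum>p\<in>?odd. inner_sign (fst p) (snd p)) + (\<Sum>p\<in>?even. inner_sign (fst p) (snd p))"
    by (subst split, rule sum.union_disjoint) (use fin in auto)
  also have "(\<Sum>p\<in>?odd. inner_sign (fst p) (snd p)) = (\<Sum>p\<in>?odd. - 1)"
    by (rule sum.cong) (auto simp: inner_sign_def)
  also have "(\<Sum>p\<in>?even. inner_sign (fst p) (snd p)) = (\<Sum>p\<in>?even. 1)"
    by (rule sum.cong) (auto simp: inner_sign_def)
  finally have diff: "?S = real (card ?even) - real (card ?odd)" by simp
  let ?AB = "real (card A) * real (card B)"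
  have "(4 * m\<^sup>2) * (4 * m\<^sup>2) \<le> card A * card B" by (rule mult_mono[OF sA sB]) auto
  then have "16 * m ^ 4 \<le> card A * card B" by (simp add: power2_eq_square power4_eq_xxxx mult_ac)
  then have "real (16 * m ^ 4) \<le> real (card A * card B)" by (simp only: of_nat_le_iff)
  then have "16 * real m ^ 4 \<le> ?AB" by simp
  moreover have "?S\<^sup>2 \<le> real m ^ 4 * ?AB"
  proof -
    have "real (2 ^ card D) = real (m ^ 4)" by (simp only: card_D)
    then have "(2::real) ^ card D = real m ^ 4" by simp
    then show ?thesis using inner_sign_sum_squared_le[OF D A B] by (simp add: mult_ac)
  qed
  moreover have "0 \<le> ?AB" by simp
  ultimately have "16 * ?S\<^sup>2 \<le> ?AB * ?AB"
    using mult_right_mono[of "16 * real m ^ 4" ?AB ?AB] by linarith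
  then have "(4 * ?S)\<^sup>2 \<le> ?AB\<^sup>2" by (simp add: power2_eq_square)
  then have "\<bar>4 * ?S\<bar> \<le> \<bar>?AB\<bar>" by (simp only: abs_le_square_iff)
  then have S: "\<bar>4 * ?S\<bar> \<le> ?AB" by (simp only: abs_of_nonneg[OF \<open>0 \<le> ?AB\<close>])
  let ?diag = "(\<lambda>a. (a, a)) ` A"
  have diag: "8 * real (card ?diag) \<le> ?AB"
  proof -
    have "2 * 2 \<le> m * m" by (rule mult_mono) (use m in auto)
    then have "8 \<le> card B" using sB by (simp add: power2_eq_square)
    moreover have "card ?diag = card A" by (intro card_image inj_onI) auto
    ultimately have "8 * card ?diag \<le> card A * card B" by (simp add: mult.commute mult_le_mono)
    then have "real (8 * card ?diag) \<le> real (card A * card B)" by (simp only: of_nat_le_iff)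
    then show ?thesis by simp
  qed
  have off: "card X \<le> card (X - ?diag) + card ?diag" if "finite X" for X
  proof -
    have "card X \<le> card ((X - ?diag) \<union> ?diag)" by (rule card_mono) (use that fA in auto)
    also have "\<dots> \<le> card (X - ?diag) + card ?diag" by (rule card_Un_le)
    finally show ?thesis .
  qed
  have "{(a, b) \<in> A \<times> B. a \<noteq> b \<and> odd (card (a \<inter> b))} = ?odd - ?diag" by auto
  moreover have "{(a, b) \<in> A \<times> B. a \<noteq> b \<and> even (card (a \<inter> b))} = ?even - ?diag" by auto
  moreover have "?AB \<le> 4 * real (card (?odd - ?diag))" "?AB \<le> 4 * real (card (?even - ?diag))"
    using off[OF fin(1)] off[OF fin(2)] diag S total diff by linarith+
  ultimately have
    "real (card A * card B) \<le> real (4 * card {(a, b) \<in> A \<times> B. a \<noteq> b \<and> odd (card (a \<inter> b))})"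
    "real (card A * card B) \<le> real (4 * card {(a, b) \<in> A \<times> B. a \<noteq> b \<and> even (card (a \<inter> b))})"
    by (simp_all only: of_nat_mult of_nat_numeral)
  then show ?thesis1 ?thesis2 by (simp_all only: of_nat_le_iff)
qed

text \<open>Transports the inner product graph on the subsets of a set of size \<open>4 * q\<close>
  to an initial segment of the naturals. The order is a fourth power so that its square root and its
  3/4 power are integers.\<close>

lemma balanced_graph_exists:
  assumes "1 \<le> q"
  obtains G :: "nat \<Rightarrow> nat \<Rightarrow> bool" where
    "\<And>u v. G u v = G v u" "\<And>u. \<not> G u u"
    "\<And>A B. A \<subseteq> {..<(2 ^ q) ^ 4} \<Longrightarrow> B \<subseteq> {..<(2 ^ q) ^ 4} \<Longrightarrow> 4 * (2 ^ q)\<^sup>2 \<le> card A \<Longrightarrow>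
      4 * (2 ^ q)\<^sup>2 \<le> card B \<Longrightarrow> card A * card B \<le> 4 * card {(a, b) \<in> A \<times> B. G a b}"
    "\<And>A B. A \<subseteq> {..<(2 ^ q) ^ 4} \<Longrightarrow> B \<subseteq> {..<(2 ^ q) ^ 4} \<Longrightarrow> 4 * (2 ^ q)\<^sup>2 \<le> card A \<Longrightarrow>
      4 * (2 ^ q)\<^sup>2 \<le> card B \<Longrightarrow> card A * card B \<le> 4 * card {(a, b) \<in> A \<times> B. a \<noteq> b \<and> \<not> G a b}"
proof -
  define D :: "nat set" where "D = {..<4 * q}"
  have D: "finite D" "2 ^ card D = (2 ^ q :: nat) ^ 4"
    by (simp_all add: D_def power_mult[symmetric] mult.commute)
  have "finite (Pow D)" "card (Pow D) = (2 ^ q :: nat) ^ 4" using D by (simp_all add: card_Pow)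
  then obtain h where h: "bij_betw h {0..<(2 ^ q) ^ 4 :: nat} (Pow D)"
    using ex_bij_betw_nat_finite[of "Pow D"] by auto
  \<comment> \<open>A set of odd size meets itself in an odd set, so \<open>u \<noteq> v\<close> is
    what excludes loops.\<close>
  define G where "G u v \<longleftrightarrow> u \<noteq> v \<and> odd (card (h u \<inter> h v))" for u v
  have m: "(2::nat) \<le> 2 ^ q" using assms by (metis power_increasing one_le_numeral power_one_right)
  have sub: "h ` A \<subseteq> Pow D" "inj_on h A" if "A \<subseteq> {..<(2 ^ q) ^ 4}" for A :: "nat set"
    using bij_betw_imp_surj_on[OF h] that inj_on_subset[OF bij_betw_imp_inj_on[OF h]]
    by (auto simp only: lessThan_atLeast0)
  have tr: "card {(a, b) \<in> h ` A \<times> h ` B. a \<noteq> b \<and> P (card (a \<inter> b))}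
      = card {(a, b) \<in> A \<times> B. a \<noteq> b \<and> P (card (h a \<inter> h b))}"
    if AB: "A \<subseteq> {..<(2 ^ q) ^ 4}" "B \<subseteq> {..<(2 ^ q) ^ 4}" for A B :: "nat set" and P
  proof -
    have inj: "inj_on h (A \<union> B)" using sub(2)[of "A \<union> B"] AB by simp
    have "{(a, b) \<in> h ` A \<times> h ` B. a \<noteq> b \<and> P (card (a \<inter> b))}
      = map_prod h h ` {(a, b) \<in> A \<times> B. a \<noteq> b \<and> P (card (h a \<inter> h b))}"
      using inj by (fastforce simp: inj_on_def image_iff)
    moreover have "inj_on (map_prod h h) {(a, b) \<in> A \<times> B. a \<noteq> b \<and> P (card (h a \<inter> h b))}"
      using inj by (auto simp: inj_on_def)
    ultimately show ?thesis by (simp add: card_image)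
  qed
  show ?thesis
  proof
    show "G u v = G v u" for u v by (auto simp: G_def Int_commute)
    show "\<not> G u u" for u by (simp add: G_def)
    fix A B :: "nat set"
    assume AB: "A \<subseteq> {..<(2 ^ q) ^ 4}" "B \<subseteq> {..<(2 ^ q) ^ 4}"
      and s: "4 * (2 ^ q)\<^sup>2 \<le> card A" "4 * (2 ^ q)\<^sup>2 \<le> card B"
    have c: "card (h ` A) = card A" "card (h ` B) = card B" using sub(2) AB card_image by blast+
    note bal = inner_product_graph_balanced[OF D m sub(1)[OF AB(1)] sub(1)[OF AB(2)], unfolded c, OF s]
    show "card A * card B \<le> 4 * card {(a, b) \<in> A \<times> B. G a b}"
      using bal(1) unfolding tr[OF AB, of "\<lambda>t. odd t"] G_def .
    have "(a \<noteq> b \<and> \<not> G a b) = (a \<noteq> b \<and> even (card (h a \<inter> h b)))" for a b by (auto simp: G_def)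
    then show "card A * card B \<le> 4 * card {(a, b) \<in> A \<times> B. a \<noteq> b \<and> \<not> G a b}"
      using bal(2) unfolding tr[OF AB, of "\<lambda>t. even t"] by (simp only:)
  qed
qed

section \<open>The extremal argument\<close>

text \<open>The bound \<open>m_large\<close> makes the fourth root \<open>m\<close> of
  \<open>n\<close> dominate the factor of one slot together with the factors 8 of the at most
  \<open>2 * k\<close> pairs containing it. Pseudorandomness enters only through
  \<open>many_adjacent\<close> and \<open>many_nonadjacent\<close>.\<close>

locale coloured_host =
  fixes n m r k :: nat and G H :: "nat \<Rightarrow> nat \<Rightarrow> bool" and col :: "nat set \<Rightarrow> nat"
  assumes n_eq: "n = m ^ 4" and r2: "2 \<le> r" and k1: "1 \<le> k"
    and m_large: "64 * (8 * r) ^ (2 * r * k) * 8 ^ (2 * k) \<le> m"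
    and G_sym: "G u v = G v u" and G_irrefl: "\<not> G u u"
    and many_adjacent: "\<And>A B. A \<subseteq> {..<n} \<Longrightarrow> B \<subseteq> {..<n} \<Longrightarrow> 4 * m\<^sup>2 \<le> card A \<Longrightarrow> 4 * m\<^sup>2 \<le> card B \<Longrightarrow>
      card A * card B \<le> 4 * card {(a, b) \<in> A \<times> B. G a b}"
    and many_nonadjacent: "\<And>A B. A \<subseteq> {..<n} \<Longrightarrow> B \<subseteq> {..<n} \<Longrightarrow> 4 * m\<^sup>2 \<le> card A \<Longrightarrow> 4 * m\<^sup>2 \<le> card B \<Longrightarrow>
      card A * card B \<le> 4 * card {(a, b) \<in> A \<times> B. a \<noteq> b \<and> \<not> G a b}"
    and H_sym: "u < k \<Longrightarrow> v < k \<Longrightarrow> H u v = H v u" and H_irrefl: "u < k \<Longrightarrow> \<not> H u u"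
    and col_range: "u < n \<Longrightarrow> v < n \<Longrightarrow> G u v \<Longrightarrow> col {u, v} \<in> {1..r}"
begin

text \<open>The slot \<open>(c, u)\<close> stands for vertex \<open>u\<close> of the copy of \<open>H\<close> in colour \<open>c\<close>. No condition is imposed
  on slots of different copies.\<close>

definition slots :: "(nat \<times> nat) set" where
  "slots = {1..r} \<times> {..<k}"

definition mono_edge :: "nat \<Rightarrow> nat \<Rightarrow> nat \<Rightarrow> bool" where
  "mono_edge c a b \<longleftrightarrow> G a b \<and> col {a, b} = c"

definition linked :: "nat \<times> nat \<Rightarrow> nat \<times> nat \<Rightarrow> bool" where
  "linked i j \<longleftrightarrow> fst i = fst j \<and> H (snd i) (snd j)"

text \<open>The condition \<open>snd i < snd j\<close> picks one orientation, so each non-edge of a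
  copy earns its factor 8 just once.\<close>

definition gaps :: "((nat \<times> nat) \<times> (nat \<times> nat)) set" where
  "gaps = {(i, j). i \<in> slots \<and> j \<in> slots \<and> fst i = fst j \<and> snd i < snd j \<and> \<not> H (snd i) (snd j)}"

text \<open>Extensionality makes a placement determined by its values on \<open>U\<close>.
  Injectivity is not demanded: two slots neither linked nor paired in \<open>E\<close> may share a
  host vertex.\<close>

definition placements where
  "placements U E = {x \<in> U \<rightarrow>\<^sub>E {..<n}.
     (\<forall>i\<in>U. \<forall>j\<in>U. linked i j \<longrightarrow> mono_edge (fst i) (x i) (x j)) \<and>
     (\<forall>(i, j)\<in>E. x i \<noteq> x j \<and> \<not> G (x i) (x j))}"

definition core :: "(nat \<times> nat) set \<Rightarrow> (nat \<times> nat \<Rightarrow> nat) \<Rightarrow> nat set" where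
  "core U x = {w \<in> {..<n}. \<forall>i\<in>U. mono_edge (fst i) (x i) w}"

text \<open>Core vertices may repeat, so a placement contributes the \<open>p\<close>-th power of
  the size of its core.\<close>

definition configs :: "(nat \<times> nat) set \<Rightarrow> ((nat \<times> nat) \<times> (nat \<times> nat)) set \<Rightarrow> nat \<Rightarrow>
    ((nat \<times> nat \<Rightarrow> nat) \<times> (nat \<Rightarrow> nat)) set" where
  "configs U E p = (SIGMA x : placements U E. {..<p} \<rightarrow>\<^sub>E core U x)"

text \<open>The total number of host vertices is the same for all states, which makes their counts
  comparable. At most \<open>r * k\<close> of them fill slots, so at least \<open>r * k\<close> core
  vertices remain.\<close>

definition count :: "(nat \<times> nat) set \<Rightarrow> ((nat \<times> nat) \<times> (nat \<times> nat)) set \<Rightarrow> nat" where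
  "count U E = card (configs U E (2 * r * k - card U))"

definition slot_factor :: nat where
  "slot_factor = (8 * r) ^ (2 * r * k)"

definition weight where
  "weight U E = count U E * slot_factor ^ card U * 8 ^ card E"

definition state where
  "state U E \<longleftrightarrow> U \<subseteq> slots \<and> E \<subseteq> gaps \<inter> U \<times> U"

section \<open>Symmetry, finiteness and size bounds\<close>

lemma mono_edge_sym: "mono_edge c a b \<Longrightarrow> mono_edge c b a"
  by (simp add: mono_edge_def G_sym insert_commute)

lemma finite_slots: "finite slots" and card_slots: "card slots = r * k"
  by (simp_all add: slots_def card_cartesian_product)

lemma gaps_subset: "gaps \<subseteq> (\<lambda>(i, v). (i, (fst i, v))) ` (slots \<times> {..<k})"
  by (force simp: gaps_def slots_def)

lemma finite_gaps: "finite gaps"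
  by (rule finite_subset[OF gaps_subset]) (simp add: finite_slots)

lemma card_gaps: "card gaps \<le> r * k * k"
proof -
  have "card gaps \<le> card (slots \<times> {..<k})"
    by (rule surj_card_le[OF _ gaps_subset]) (simp add: finite_slots)
  then show ?thesis by (simp add: card_cartesian_product card_slots)
qed

lemma slot_factor_pos: "0 < slot_factor"
  using r2 by (simp add: slot_factor_def)

lemma m_large': "64 * slot_factor * 8 ^ (2 * k) \<le> m"
  using m_large by (simp add: slot_factor_def)

lemma m_ge_64: "64 \<le> m"
proof -
  have "64 * 1 * 1 \<le> 64 * slot_factor * (8 ^ (2 * k) :: nat)"
    using slot_factor_pos by (intro mult_le_mono) auto
  then show ?thesis using m_large' by linarith
qed

lemma state_finite:
  assumes "state U E"
  shows "finite U" "finite E" "card U \<le> r * k" "card E \<le> r * k * k"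
proof -
  have s: "U \<subseteq> slots" "E \<subseteq> gaps" using assms by (auto simp: state_def)
  show "finite U" "finite E" using s finite_slots finite_gaps by (auto intro: finite_subset)
  show "card U \<le> r * k" using card_mono[OF finite_slots s(1)] by (simp add: card_slots)
  show "card E \<le> r * k * k" using card_mono[OF finite_gaps s(2)] card_gaps by simp
qed

lemma finite_placements: "finite U \<Longrightarrow> finite (placements U E)"
  by (rule finite_subset[of _ "U \<rightarrow>\<^sub>E {..<n}"]) (auto simp: placements_def intro: finite_PiE)

lemma card_placements_le: "finite U \<Longrightarrow> card (placements U E) \<le> n ^ card U"
  using card_mono[of "U \<rightarrow>\<^sub>E {..<n}" "placements U E"]
  by (auto simp: placements_def card_PiE intro: finite_PiE)

lemma finite_core: "finite (core U x)"
  by (simp add: core_def)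

lemma finite_configs: "finite U \<Longrightarrow> finite (configs U E p)"
  unfolding configs_def by (intro finite_SigmaI finite_placements finite_PiE finite_core finite_lessThan)

lemma card_configs:
  "finite U \<Longrightarrow> card (configs U E p) = (\<Sum>x\<in>placements U E. card (core U x) ^ p)"
  unfolding configs_def
  by (subst card_SigmaI) (auto simp: finite_placements finite_core card_PiE intro: finite_PiE)

lemma count_empty: "count {} {} = n ^ (2 * r * k)"
  by (simp add: count_def card_configs placements_def core_def)

section \<open>Configurations with small cores\<close>

text \<open>The empty state has weight \<open>n ^ (2 * r * k)\<close>, so the count of a heavier
  state is at least this number divided by its slot and pair factors. The bracket on the left bounds
  the configurations with core below \<open>m ^ 3\<close>; it is smaller than
  \<open>n ^ (2 * r * k)\<close> by a factor \<open>m\<close> for each core vertex, which outweighs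
  those factors.\<close>

lemma small_cores_negligible:
  assumes st: "state U E" and w: "weight {} {} \<le> weight U E"
  shows "16 * (n ^ card U * (m ^ 3) ^ (2 * r * k - card U)) \<le> count U E"
proof -
  let ?p = "2 * r * k - card U"
  let ?B = "slot_factor ^ (r * k) * 8 ^ (r * k * k)"
  note fin = state_finite[OF st]
  have rk: "1 \<le> r * k" using r2 k1 by (simp add: Suc_le_eq)
  have p: "r * k \<le> ?p" "card U + ?p = 2 * r * k" using fin(3) by auto
  \<comment> \<open>\<open>?B\<close> bounds the factors a state can collect from at most
    \<open>r * k\<close> slots and \<open>r * k * k\<close> pairs. The power \<open>r * k\<close> of
    \<open>m_large'\<close> pays for them, and its factor 64 supplies the 16.\<close>
  have "16 * ?B \<le> m ^ ?p"
  proof -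
    have "(16::nat) \<le> 64 ^ (r * k)" using rk power_increasing[of 1 "r * k" "64::nat"] by simp
    moreover have "(8::nat) ^ (r * k * k) \<le> 8 ^ (2 * (r * k * k))" by (rule power_increasing) auto
    ultimately have "16 * ?B \<le> 64 ^ (r * k) * (slot_factor ^ (r * k) * 8 ^ (2 * (r * k * k)))"
      by (intro mult_le_mono le_refl)
    also have "\<dots> = (64 * slot_factor * 8 ^ (2 * k)) ^ (r * k)"
      by (simp add: power_mult_distrib power_mult[symmetric] mult_ac)
    also have "\<dots> \<le> m ^ (r * k)" by (rule power_mono[OF m_large']) simp
    also have "\<dots> \<le> m ^ ?p" using p m_ge_64 by (intro power_increasing) auto
    finally show ?thesis .
  qed
  then have "16 * (n ^ card U * (m ^ 3) ^ ?p) * ?B \<le> n ^ card U * (m ^ 3) ^ ?p * m ^ ?p"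
    by (simp add: mult_ac mult_left_mono)
  also have "\<dots> = n ^ card U * n ^ ?p"
    by (simp add: n_eq power_mult_distrib[symmetric] power_Suc2[symmetric] del: power_Suc)
  also have "\<dots> = weight {} {}"
    by (simp add: weight_def count_empty power_add[symmetric] p(2))
  also have "\<dots> \<le> count U E * slot_factor ^ card U * 8 ^ card E" using w by (simp add: weight_def)
  also have "\<dots> \<le> count U E * slot_factor ^ (r * k) * 8 ^ (r * k * k)"
    using fin(3,4) slot_factor_pos by (intro mult_mono power_increasing) auto
  finally have "16 * (n ^ card U * (m ^ 3) ^ ?p) * ?B \<le> count U E * ?B" by (simp add: mult_ac)
  moreover have "0 < ?B" using slot_factor_pos by simp
  ultimately show ?thesis by (metis mult_le_cancel2)
qed

section \<open>Promoting a core vertex to a slot\<close>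

lemma core_insert:
  assumes "i \<notin> U"
  shows "core (insert i U) (x(i := w)) = core U x \<inter> {b. mono_edge (fst i) w b}"
proof -
  have "(\<forall>j\<in>U. mono_edge (fst j) ((x(i := w)) j) b) = (\<forall>j\<in>U. mono_edge (fst j) (x j) b)" for b
    using assms by (intro ball_cong) auto
  then show ?thesis by (auto simp: core_def)
qed

text \<open>A slot linked to \<open>i\<close> belongs to the same copy, and \<open>w\<close> is
  joined to it in the colour of that copy. No pair in \<open>E\<close> involves \<open>i\<close>,
  because \<open>E \<subseteq> U \<times> U\<close>.\<close>

lemma placements_extend:
  assumes st: "state U E" and i: "i \<in> slots" "i \<notin> U" and x: "x \<in> placements U E" and w: "w \<in> core U x"
  shows "x(i := w) \<in> placements (insert i U) E"
proof -
  have xP: "x \<in> U \<rightarrow>\<^sub>E {..<n}"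
    and xl: "\<And>j l. j \<in> U \<Longrightarrow> l \<in> U \<Longrightarrow> linked j l \<Longrightarrow> mono_edge (fst j) (x j) (x l)"
    and xE: "\<And>j l. (j, l) \<in> E \<Longrightarrow> x j \<noteq> x l \<and> \<not> G (x j) (x l)"
    using x by (auto simp: placements_def)
  have wn: "w < n" and wl: "\<And>j. j \<in> U \<Longrightarrow> mono_edge (fst j) (x j) w" using w by (auto simp: core_def)
  have EU: "E \<subseteq> U \<times> U" using st by (auto simp: state_def)
  have ii: "\<not> linked i i" using i H_irrefl by (auto simp: linked_def slots_def)
  have "x(i := w) \<in> insert i U \<rightarrow>\<^sub>E {..<n}"
    using xP wn by (auto simp: PiE_iff extensional_def)
  moreover have "mono_edge (fst j) ((x(i := w)) j) ((x(i := w)) l)"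
    if jl: "j \<in> insert i U" "l \<in> insert i U" "linked j l" for j l
  proof -
    consider "j \<in> U" "l \<in> U" "j \<noteq> i" "l \<noteq> i" | "j = i" "l \<in> U" "l \<noteq> i" | "l = i" "j \<in> U" "j \<noteq> i"
      using jl ii i(2) by blast
    then show ?thesis
    proof cases
      case 1 then show ?thesis using xl jl by simp
    next
      case 2
      then have "fst i = fst l" using jl by (simp add: linked_def)
      then show ?thesis using 2 wl[of l] mono_edge_sym by simp
    next
      case 3 then show ?thesis using wl by simp
    qed
  qed
  moreover have "(x(i := w)) j \<noteq> (x(i := w)) l \<and> \<not> G ((x(i := w)) j) ((x(i := w)) l)" if "(j, l) \<in> E" for j l
  proof -
    have "j \<noteq> i" "l \<noteq> i" using that EU i(2) by auto
    then show ?thesis using xE[OF that] by simp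
  qed
  ultimately show ?thesis unfolding placements_def by blast
qed

text \<open>Placements are \<open>undefined\<close> at \<open>i\<close>, so \<open>x(i := w)\<close>
  determines \<open>x\<close> and \<open>w\<close>. The inequality can be strict, since the vertex
  in slot \<open>i\<close> need not be joined to the slots of other copies.\<close>

lemma card_configs_insert_ge:
  assumes st: "state U E" and i: "i \<in> slots" "i \<notin> U"
  shows "(\<Sum>x\<in>placements U E. \<Sum>w\<in>core U x. card (core U x \<inter> {b. mono_edge (fst i) w b}) ^ p)
    \<le> card (configs (insert i U) E p)"
proof -
  note fin = state_finite[OF st]
  let ?S = "SIGMA x : placements U E. core U x"
  let ?f = "\<lambda>(x, w). x(i := w)"
  have inj: "inj_on ?f ?S"
  proof (rule inj_onI)
    fix s t assume stS: "s \<in> ?S" "t \<in> ?S" and eq: "?f s = ?f t"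
    obtain x w where s1: "s = (x, w)" by (cases s)
    obtain x' w' where s2: "t = (x', w')" by (cases t)
    note s = s1 s2
    have e: "x(i := w) = x'(i := w')" using eq s by simp
    have "x \<in> placements U E" "x' \<in> placements U E" using stS s by simp_all
    then have xx': "x \<in> U \<rightarrow>\<^sub>E {..<n}" "x' \<in> U \<rightarrow>\<^sub>E {..<n}" by (simp_all add: placements_def)
    have "x i = x' i" using PiE_arb[OF xx'(1) i(2)] PiE_arb[OF xx'(2) i(2)] by simp
    moreover have "x j = x' j" if "j \<noteq> i" for j using fun_cong[OF e, of j] that by simp
    ultimately have "x = x'" by (metis ext)
    moreover have "w = w'" using fun_cong[OF e, of i] by simp
    ultimately show "s = t" using s by simp
  qed
  have "(\<Sum>x\<in>placements U E. \<Sum>w\<in>core U x. card (core U x \<inter> {b. mono_edge (fst i) w b}) ^ p)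
      = (\<Sum>(x, w)\<in>?S. card (core (insert i U) (x(i := w))) ^ p)"
    by (simp add: sum.Sigma finite_placements[OF fin(1)] finite_core core_insert[OF i(2)])
  also have "\<dots> = (\<Sum>z\<in>?f ` ?S. card (core (insert i U) z) ^ p)"
    by (subst sum.reindex[OF inj]) (simp add: case_prod_unfold)
  also have "\<dots> \<le> (\<Sum>z\<in>placements (insert i U) E. card (core (insert i U) z) ^ p)"
    by (rule sum_mono2) (use fin placements_extend[OF st i] in \<open>auto intro!: finite_placements\<close>)
  also have "\<dots> = card (configs (insert i U) E p)" using fin by (simp add: card_configs)
  finally show ?thesis .
qed

text \<open>At least a quarter of the pairs in \<open>W\<close> are edges. Split them by colour and
  first endpoint, and apply the power mean inequality to the resulting \<open>r * card W\<close>
  degrees. The factor \<open>r\<close> on the left completes the power of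
  \<open>4 * r\<close>.\<close>

lemma core_colour_classes:
  assumes W: "W \<subseteq> {..<n}" and big: "m ^ 3 \<le> card W"
  shows "r * card W ^ Suc (Suc q)
    \<le> (4 * r) ^ Suc q * (\<Sum>c\<in>{1..r}. \<Sum>w\<in>W. card (W \<inter> {b. mono_edge c w b}) ^ Suc q)"
proof -
  have fW: "finite W" using W finite_subset by blast
  let ?a = "\<lambda>(c, w). real (card (W \<inter> {b. mono_edge c w b}))"
  let ?I = "{1..r} \<times> W"
  let ?T = "\<Sum>c\<in>{1..r}. \<Sum>w\<in>W. card (W \<inter> {b. mono_edge c w b}) ^ Suc q"
  have m4: "4 * m\<^sup>2 \<le> m ^ 3" using m_ge_64 by (simp add: power2_eq_square power3_eq_cube)
  then have W4: "4 * m\<^sup>2 \<le> card W" using big by simp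
  have W0: "0 < card W" using big m_ge_64 by (metis gr_zeroI le_zero_eq not_numeral_le_zero power_eq_0_iff)
  have "{(a, b) \<in> W \<times> W. G a b} = (\<Union>c\<in>{1..r}. SIGMA w : W. W \<inter> {b. mono_edge c w b})"
  proof -
    have "1 \<le> col {a, b} \<and> col {a, b} \<le> r" if "a \<in> W" "b \<in> W" "G a b" for a b
      using col_range[of a b] that W by auto
    then show ?thesis by (auto simp: mono_edge_def)
  qed
  then have "card {(a, b) \<in> W \<times> W. G a b} = (\<Sum>c\<in>{1..r}. card (SIGMA w : W. W \<inter> {b. mono_edge c w b}))"
    using fW by (simp only:, subst card_UN_disjoint) (auto simp: mono_edge_def)
  also have "\<dots> = (\<Sum>c\<in>{1..r}. \<Sum>w\<in>W. card (W \<inter> {b. mono_edge c w b}))"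
    using fW by (simp add: card_SigmaI)
  finally have g: "card {(a, b) \<in> W \<times> W. G a b} = (\<Sum>c\<in>{1..r}. \<Sum>w\<in>W. card (W \<inter> {b. mono_edge c w b}))" .
  have "card W * card W \<le> 4 * (\<Sum>c\<in>{1..r}. \<Sum>w\<in>W. card (W \<inter> {b. mono_edge c w b}))"
    using many_adjacent[OF W W W4 W4] unfolding g .
  then have "real (card W * card W) \<le> real (4 * (\<Sum>c\<in>{1..r}. \<Sum>w\<in>W. card (W \<inter> {b. mono_edge c w b})))"
    by (simp only: of_nat_le_iff)
  then have "real (card W) * real (card W) \<le> 4 * (\<Sum>z\<in>?I. ?a z)"
    by (simp add: sum.cartesian_product case_prod_unfold)
  then have "(real (card W) * real (card W)) ^ Suc q \<le> (4 * (\<Sum>z\<in>?I. ?a z)) ^ Suc q"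
    by (intro power_mono) auto
  also have "\<dots> = 4 ^ Suc q * (\<Sum>z\<in>?I. ?a z) ^ Suc q" by (rule power_mult_distrib)
  also have "\<dots> \<le> 4 ^ Suc q * (real (card ?I) ^ q * (\<Sum>z\<in>?I. ?a z ^ Suc q))"
    by (intro mult_left_mono power_sum_le_card_mult_sum_power) (use fW in auto)
  also have "(\<Sum>z\<in>?I. ?a z ^ Suc q) = real ?T"
    by (simp add: sum.cartesian_product case_prod_unfold)
  finally have "real ((card W * card W) ^ Suc q) \<le> real (4 ^ Suc q * (card ?I ^ q * ?T))"
    by (simp only: of_nat_mult of_nat_power of_nat_numeral)
  then have "(card W * card W) ^ Suc q \<le> 4 ^ Suc q * (card ?I ^ q * ?T)" by (simp only: of_nat_le_iff)
  then have "r * (card W * card W) ^ Suc q \<le> r * (4 ^ Suc q * (card ?I ^ q * ?T))" by (rule mult_le_mono2)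
  then have "card W ^ q * (r * card W ^ Suc (Suc q)) \<le> card W ^ q * ((4 * r) ^ Suc q * ?T)"
    by (simp add: card_cartesian_product power_mult_distrib mult_ac)
  then show ?thesis using W0 by simp
qed

text \<open>The core vertices are joined to every slot in the colour of that slot, so a core vertex may become
  any missing vertex of any copy. The colour is then chosen so that the core shrinks least.\<close>

lemma extension_exists:
  assumes st: "state U E" and w: "weight {} {} \<le> weight U E"
    and v: "\<And>c. c \<in> {1..r} \<Longrightarrow> v c < k \<and> (c, v c) \<notin> U"
  shows "\<exists>c\<in>{1..r}. weight U E < weight (insert (c, v c) U) E"
proof (rule ccontr)
  assume neg: "\<not> ?thesis"
  note fin = state_finite[OF st]
  have rk: "2 \<le> r * k" using r2 k1 by (metis mult_le_mono mult.right_neutral)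
  \<comment> \<open>At least \<open>r * k \<ge> 2\<close> core vertices are present, so promoting
    one leaves a positive number \<open>Suc q\<close>.\<close>
  obtain q where q: "2 * r * k - card U = Suc (Suc q)"
  proof -
    have "2 \<le> 2 * r * k - card U" using fin(3) rk by (simp add: mult.assoc)
    then show ?thesis using that[of "2 * r * k - card U - 2"] by simp
  qed
  let ?N = "count U E"
  let ?Nc = "\<lambda>c. count (insert (c, v c) U) E"
  let ?small = "n ^ card U * (m ^ 3) ^ Suc (Suc q)"
  have small: "16 * ?small \<le> ?N" using small_cores_negligible[OF st w] unfolding q .
  have n0: "0 < n" "0 < m" using m_ge_64 by (simp_all add: n_eq)
  then have "0 < 16 * ?small" by simp
  then have N0: "0 < ?N" using small by linarith
  have le: "?Nc c * slot_factor \<le> ?N" if c: "c \<in> {1..r}" for c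
  proof -
    have "card (insert (c, v c) U) = Suc (card U)" using fin v[OF c] by simp
    moreover have "weight (insert (c, v c) U) E \<le> weight U E" using neg c by (simp add: not_less)
    ultimately have "(?Nc c * slot_factor) * (slot_factor ^ card U * 8 ^ card E) \<le> ?N * (slot_factor ^ card U * 8 ^ card E)"
      by (simp add: weight_def mult_ac)
    then show ?thesis using slot_factor_pos by simp
  qed
  let ?cls = "\<lambda>x. \<Sum>c\<in>{1..r}. \<Sum>w\<in>core U x. card (core U x \<inter> {b. mono_edge c w b}) ^ Suc q"
  have cnt: "?N = (\<Sum>x\<in>placements U E. card (core U x) ^ Suc (Suc q))"
    unfolding count_def q by (rule card_configs[OF fin(1)])
  have "r * ?N = (\<Sum>x\<in>placements U E. r * card (core U x) ^ Suc (Suc q))"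
    unfolding cnt by (rule sum_distrib_left)
  \<comment> \<open>The second summand covers the cores below \<open>m ^ 3\<close>, to which
    \<open>core_colour_classes\<close> does not apply.\<close>
  also have "\<dots> \<le> (\<Sum>x\<in>placements U E. (4 * r) ^ Suc q * ?cls x + r * (m ^ 3) ^ Suc (Suc q))"
  proof (rule sum_mono)
    fix x
    show "r * card (core U x) ^ Suc (Suc q) \<le> (4 * r) ^ Suc q * ?cls x + r * (m ^ 3) ^ Suc (Suc q)"
    proof (cases "m ^ 3 \<le> card (core U x)")
      case True
      have "core U x \<subseteq> {..<n}" by (auto simp: core_def)
      from core_colour_classes[OF this True, of q] show ?thesis by (rule trans_le_add1)
    next
      case False
      then have "card (core U x) ^ Suc (Suc q) \<le> (m ^ 3) ^ Suc (Suc q)" by (intro power_mono) auto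
      then show ?thesis by (intro trans_le_add2 mult_le_mono2)
    qed
  qed
  also have "\<dots> = (4 * r) ^ Suc q * (\<Sum>x\<in>placements U E. ?cls x) + card (placements U E) * (r * (m ^ 3) ^ Suc (Suc q))"
    by (simp only: sum.distrib sum_distrib_left sum_constant of_nat_id)
  also have "(\<Sum>x\<in>placements U E. ?cls x)
      = (\<Sum>c\<in>{1..r}. \<Sum>x\<in>placements U E. \<Sum>w\<in>core U x. card (core U x \<inter> {b. mono_edge c w b}) ^ Suc q)"
    by (rule sum.swap)
  finally have main: "r * ?N \<le> (4 * r) ^ Suc q *
      (\<Sum>c\<in>{1..r}. \<Sum>x\<in>placements U E. \<Sum>w\<in>core U x. card (core U x \<inter> {b. mono_edge c w b}) ^ Suc q)
      + card (placements U E) * (r * (m ^ 3) ^ Suc (Suc q))" .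
  have 1: "(\<Sum>c\<in>{1..r}. \<Sum>x\<in>placements U E. \<Sum>w\<in>core U x. card (core U x \<inter> {b. mono_edge c w b}) ^ Suc q)
      \<le> (\<Sum>c\<in>{1..r}. ?Nc c)"
  proof (rule sum_mono)
    fix c assume c: "c \<in> {1..r}"
    have "(c, v c) \<in> slots" using c v[OF c] by (auto simp: slots_def)
    from card_configs_insert_ge[OF st this v[OF c, THEN conjunct2], of "Suc q"]
    have "(\<Sum>x\<in>placements U E. \<Sum>w\<in>core U x. card (core U x \<inter> {b. mono_edge c w b}) ^ Suc q)
        \<le> card (configs (insert (c, v c) U) E (Suc q))" by (simp only: fst_conv)
    moreover have "2 * r * k - card (insert (c, v c) U) = Suc q" using fin v[OF c] q by simp
    ultimately show "(\<Sum>x\<in>placements U E. \<Sum>w\<in>core U x. card (core U x \<inter> {b. mono_edge c w b}) ^ Suc q) \<le> ?Nc c"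
      by (simp only: count_def)
  qed
  have 2: "card (placements U E) * (r * (m ^ 3) ^ Suc (Suc q)) \<le> r * ?small"
    using card_placements_le[OF fin(1), of E] by (simp add: mult_ac del: power_Suc)
  have 3: "slot_factor * (\<Sum>c\<in>{1..r}. ?Nc c) \<le> r * ?N"
  proof -
    have "(\<Sum>c\<in>{1..r}. ?Nc c * slot_factor) \<le> (\<Sum>c\<in>{1..r}. ?N)" by (rule sum_mono) (rule le)
    then show ?thesis by (simp add: sum_distrib_left mult.commute)
  qed
  \<comment> \<open>The source of the base \<open>8 * r\<close>: density and colours cost
    \<open>4 * r\<close> per remaining core vertex, and doubling the base leaves a factor 2 to
    spare.\<close>
  have 4: "2 * (4 * r) ^ Suc q \<le> slot_factor"
  proof -
    have "2 * (4 * r) ^ Suc q \<le> 2 ^ Suc q * (4 * r) ^ Suc q" by (rule mult_le_mono1) simp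
    also have "\<dots> = (2 * (4 * r)) ^ Suc q" by (simp only: power_mult_distrib)
    also have "\<dots> = (8 * r) ^ Suc q" by (simp del: power_Suc)
    also have "\<dots> \<le> slot_factor" unfolding slot_factor_def using q r2 by (intro power_increasing) auto
    finally show ?thesis .
  qed
  \<comment> \<open>Small cores account for at most 1/16 of the count, so \<open>?A * ?T\<close> is
    at least 15/16 of \<open>r * ?N\<close>, whereas failure of every extension caps it at one
    half.\<close>
  let ?A = "(4 * r) ^ Suc q" and ?T = "\<Sum>c\<in>{1..r}. ?Nc c"
  have "r * ?N \<le> ?A * ?T + r * ?small"
    using main mult_le_mono2[OF 1, of ?A] 2 by linarith
  then have "16 * (r * ?N) \<le> 16 * (?A * ?T) + r * ?N"
    using mult_le_mono2[OF small, of r] by linarith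
  then have "15 * (r * ?N) \<le> 16 * (?A * ?T)" by linarith
  moreover have "2 * (?A * ?T) \<le> r * ?N"
    using mult_le_mono1[OF 4, of ?T] 3 by linarith
  moreover have "0 < r * ?N" using N0 r2 by simp
  ultimately show False by linarith
qed

section \<open>Deleting a slot\<close>

lemma placements_delete:
  assumes "x \<in> placements U E"
  shows "x(i := undefined) \<in> placements (U - {i}) {(a, b) \<in> E. a \<noteq> i \<and> b \<noteq> i}"
proof -
  have "x \<in> U \<rightarrow>\<^sub>E {..<n}" using assms by (simp add: placements_def)
  then have "x(i := undefined) \<in> (U - {i}) \<rightarrow>\<^sub>E {..<n}" by (simp add: PiE_iff extensional_def)
  then show ?thesis using assms by (auto simp: placements_def)
qed

lemma core_delete: "core U x \<subseteq> core (U - {i}) (x(i := undefined))"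
  by (auto simp: core_def)

text \<open>The partner of \<open>i\<close> in a pair lies in the same copy, so it is determined by
  its vertex; \<open>i\<close> may be the first or the second entry.\<close>

lemma card_gaps_at_slot_le:
  assumes "E \<subseteq> gaps"
  shows "card E \<le> card {(a, b) \<in> E. a \<noteq> i \<and> b \<noteq> i} + 2 * k"
proof -
  let ?P = "\<lambda>v. (i, (fst i, v))" and ?Q = "\<lambda>v. ((fst i, v), i)"
  have "E \<subseteq> {(a, b) \<in> E. a \<noteq> i \<and> b \<noteq> i} \<union> (?P ` {..<k} \<union> ?Q ` {..<k})"
    using assms by (force simp: gaps_def slots_def)
  then have "card E \<le> card ({(a, b) \<in> E. a \<noteq> i \<and> b \<noteq> i} \<union> (?P ` {..<k} \<union> ?Q ` {..<k}))"
    by (rule card_mono[rotated]) (use finite_subset[OF assms finite_gaps] in \<open>auto intro: rev_finite_subset\<close>)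
  also have "\<dots> \<le> card {(a, b) \<in> E. a \<noteq> i \<and> b \<noteq> i} + card (?P ` {..<k} \<union> ?Q ` {..<k})"
    by (rule card_Un_le)
  also have "card (?P ` {..<k} \<union> ?Q ` {..<k}) \<le> card (?P ` {..<k}) + card (?Q ` {..<k})"
    by (rule card_Un_le)
  also have "card (?P ` {..<k}) + card (?Q ` {..<k}) \<le> k + k"
    by (intro add_mono) (use card_image_le[of "{..<k}"] in auto)
  finally show ?thesis by (simp add: mult_2)
qed

text \<open>Compare with the state lacking slot \<open>i\<close> and its pairs. By maximality its
  count is at most \<open>slot_factor * 8 ^ (2 * k)\<close> times \<open>count U E\<close>. It has
  one more core vertex, with at least \<open>m ^ 3\<close> choices unless the core is small, so
  erasing slot \<open>i\<close> leaves few configurations. Restoring it within small fibres gives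
  back a factor of only \<open>4 * m\<^sup>2\<close>, and \<open>m_large'\<close> absorbs the
  rest.\<close>

lemma few_small_fibres:
  assumes st: "state U E" and max: "\<And>U' E'. state U' E' \<Longrightarrow> weight U' E' \<le> weight U E" and i: "i \<in> U"
  shows "8 * card {(x, y) \<in> configs U E (2 * r * k - card U).
      card {a. (x(i := a), y) \<in> configs U E (2 * r * k - card U)} < 4 * m\<^sup>2} \<le> count U E"
proof -
  note fin = state_finite[OF st]
  define p where "p = 2 * r * k - card U"
  let ?U = "U - {i}" and ?E = "{(a, b) \<in> E. a \<noteq> i \<and> b \<noteq> i}"
  let ?bad = "card {(x, y) \<in> configs U E p. card {a. (x(i := a), y) \<in> configs U E p} < 4 * m\<^sup>2}"
  have st': "state ?U ?E" and st0: "state {} {}" using st by (auto simp: state_def)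
  note fin' = state_finite[OF st']
  have m0: "0 < m" using m_ge_64 by simp
  have cU: "card U = Suc (card ?U)" using fin(1) i by (rule card.remove)
  have p': "2 * r * k - card ?U = Suc p" using fin(3) cU by (simp add: p_def)
  let ?Y = "n ^ card ?U * (m ^ 3) ^ Suc p"
  have "16 * (n ^ card U * (m ^ 3) ^ p) \<le> count U E"
    using small_cores_negligible[OF st max[OF st0]] unfolding p_def .
  \<comment> \<open>Trading a slot for a core vertex replaces a factor \<open>n\<close> by
    \<open>m ^ 3\<close>, which leaves a factor \<open>m\<close>.\<close>
  moreover have "n ^ card U * (m ^ 3) ^ p = m * ?Y"
    unfolding cU by (simp add: n_eq power3_eq_cube power4_eq_xxxx mult_ac)
  ultimately have Y: "16 * (m * ?Y) \<le> count U E" by simp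
  have "weight ?U ?E \<le> weight U E" by (rule max[OF st'])
  moreover have "8 ^ card E \<le> (8::nat) ^ (card ?E + 2 * k)"
    by (rule power_increasing) (use card_gaps_at_slot_le[of E i] st in \<open>auto simp: state_def\<close>)
  ultimately have "count ?U ?E * slot_factor ^ card ?U * 8 ^ card ?E
      \<le> count U E * slot_factor ^ card U * 8 ^ (card ?E + 2 * k)"
    unfolding weight_def by (meson le_trans mult_le_mono2)
  then have "count ?U ?E * (slot_factor ^ card ?U * 8 ^ card ?E)
      \<le> (count U E * slot_factor * 8 ^ (2 * k)) * (slot_factor ^ card ?U * 8 ^ card ?E)"
    unfolding cU by (simp add: power_add mult_ac)
  then have cnt: "count ?U ?E \<le> count U E * slot_factor * 8 ^ (2 * k)"
    using slot_factor_pos by simp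
  have "(\<lambda>(x, y). (x(i := undefined), y)) ` configs U E p \<subseteq> configs ?U ?E p"
    using placements_delete[of _ U E i] core_delete[of U _ i] by (fastforce simp: configs_def PiE_iff)
  then have "card ((\<lambda>(x, y). (x(i := undefined), y)) ` configs U E p) \<le> card (configs ?U ?E p)"
    by (rule card_mono[OF finite_configs[OF fin'(1)]])
  then have bad: "?bad \<le> 4 * m\<^sup>2 * card (configs ?U ?E p)"
    using card_small_fibres_le[OF finite_configs[OF fin(1)], of E p i "4 * m\<^sup>2"]
    by (meson le_trans mult_le_mono2)
  \<comment> \<open>Erasing slot \<open>i\<close> keeps \<open>p\<close> core vertices, but the
    count of the smaller state uses \<open>Suc p\<close>. Large cores supply the missing factor
    \<open>m ^ 3\<close>; small ones go into the second summand.\<close>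
  have "m ^ 3 * card (configs ?U ?E p) = (\<Sum>x\<in>placements ?U ?E. m ^ 3 * card (core ?U x) ^ p)"
    by (simp only: card_configs[OF fin'(1)] sum_distrib_left)
  also have "\<dots> \<le> (\<Sum>x\<in>placements ?U ?E. card (core ?U x) ^ Suc p + (m ^ 3) ^ Suc p)"
  proof (rule sum_mono)
    fix x
    show "m ^ 3 * card (core ?U x) ^ p \<le> card (core ?U x) ^ Suc p + (m ^ 3) ^ Suc p"
    proof (cases "m ^ 3 \<le> card (core ?U x)")
      case True
      then show ?thesis by (simp add: trans_le_add1)
    next
      case False
      then have "card (core ?U x) ^ p \<le> (m ^ 3) ^ p" by (intro power_mono) auto
      then have "m ^ 3 * card (core ?U x) ^ p \<le> (m ^ 3) ^ Suc p" by (simp add: mult_le_mono2)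
      then show ?thesis by (rule trans_le_add2)
    qed
  qed
  also have "\<dots> = count ?U ?E + card (placements ?U ?E) * (m ^ 3) ^ Suc p"
    by (simp only: sum.distrib sum_constant of_nat_id count_def p' card_configs[OF fin'(1)])
  also have "\<dots> \<le> count U E * slot_factor * 8 ^ (2 * k) + ?Y"
    by (intro add_mono cnt mult_le_mono1 card_placements_le fin'(1))
  finally have del: "m ^ 3 * card (configs ?U ?E p) \<le> count U E * slot_factor * 8 ^ (2 * k) + ?Y" .
  let ?c = "card (configs ?U ?E p)" and ?N = "count U E"
  have "m * ?bad \<le> 4 * (m ^ 3 * ?c)"
    using mult_le_mono2[OF bad, of m] by (simp add: power2_eq_square power3_eq_cube mult_ac)
  then have "m * ?bad \<le> 4 * (?N * slot_factor * 8 ^ (2 * k)) + 4 * ?Y" using del by linarith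
  then have "16 * (m * ?bad) \<le> ?N * (64 * slot_factor * 8 ^ (2 * k)) + 64 * ?Y" by simp
  also have "\<dots> \<le> ?N * m + ?N * m"
  proof (rule add_mono)
    show "?N * (64 * slot_factor * 8 ^ (2 * k)) \<le> ?N * m" by (rule mult_le_mono2[OF m_large'])
    have "64 * ?Y \<le> m * ?Y" by (rule mult_le_mono1[OF m_ge_64])
    also have "\<dots> \<le> ?N" using Y by linarith
    also have "\<dots> \<le> ?N * m" using m0 by simp
    finally show "64 * ?Y \<le> ?N * m" .
  qed
  finally have "16 * (m * ?bad) \<le> ?N * m + ?N * m" .
  moreover have "8 * b \<le> N" if "16 * (m * b) \<le> N * m + N * m" for b N :: nat
  proof -
    have "16 * (m * b) = 2 * (m * (8 * b))" "N * m + N * m = 2 * (m * N)" by simp_all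
    then have "m * (8 * b) \<le> m * N" using that by linarith
    then show ?thesis using m0 by simp
  qed
  ultimately show ?thesis unfolding p_def by blast
qed

section \<open>Independent refilling and enforcing non-edges\<close>

text \<open>No condition involves both \<open>i\<close> and \<open>l\<close>. Hence each condition
  on a pair of slots in the new placement is one that \<open>x\<close> or \<open>x'\<close> already
  satisfies, and the entries of \<open>y\<close> lie in both cores.\<close>

lemma configs_exchange:
  assumes i: "i \<in> U" and sep: "\<not> linked i l" "\<not> linked l i" "(i, l) \<notin> E" "(l, i) \<notin> E" "\<not> linked i i" "(i, i) \<notin> E"
    and x: "(x, y) \<in> configs U E p" and x': "(x', y) \<in> configs U E p"
    and agree: "\<And>j. j \<noteq> i \<Longrightarrow> j \<noteq> l \<Longrightarrow> x j = x' j"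
  shows "(x(i := x' i), y) \<in> configs U E p"
proof -
  let ?z = "x(i := x' i)"
  have P: "x \<in> U \<rightarrow>\<^sub>E {..<n}" "x' \<in> U \<rightarrow>\<^sub>E {..<n}"
    and L: "\<And>j l. j \<in> U \<Longrightarrow> l \<in> U \<Longrightarrow> linked j l \<Longrightarrow> mono_edge (fst j) (x j) (x l)"
      "\<And>j l. j \<in> U \<Longrightarrow> l \<in> U \<Longrightarrow> linked j l \<Longrightarrow> mono_edge (fst j) (x' j) (x' l)"
    and N: "\<And>j l. (j, l) \<in> E \<Longrightarrow> x j \<noteq> x l \<and> \<not> G (x j) (x l)"
      "\<And>j l. (j, l) \<in> E \<Longrightarrow> x' j \<noteq> x' l \<and> \<not> G (x' j) (x' l)"
    and Y: "y \<in> {..<p} \<rightarrow>\<^sub>E core U x" "y \<in> {..<p} \<rightarrow>\<^sub>E core U x'"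
    using x x' by (auto simp: configs_def placements_def)
  have same: "(?z a = x a \<and> ?z b = x b) \<or> (?z a = x' a \<and> ?z b = x' b)"
    if "(a, b) \<noteq> (i, l)" "(a, b) \<noteq> (l, i)" for a b
    using that agree[of a] agree[of b] by auto
  have "mono_edge (fst a) (?z a) (?z b)" if "a \<in> U" "b \<in> U" "linked a b" for a b
  proof -
    have "(a, b) \<noteq> (i, l)" "(a, b) \<noteq> (l, i)" using that sep by auto
    from same[OF this] show ?thesis using L(1)[OF that] L(2)[OF that] by metis
  qed
  moreover have "?z a \<noteq> ?z b \<and> \<not> G (?z a) (?z b)" if "(a, b) \<in> E" for a b
  proof -
    have "(a, b) \<noteq> (i, l)" "(a, b) \<noteq> (l, i)" using that sep by auto
    from same[OF this] show ?thesis using N(1)[OF that] N(2)[OF that] by metis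
  qed
  moreover have "?z \<in> U \<rightarrow>\<^sub>E {..<n}" using P i by (simp add: PiE_iff extensional_def)
  ultimately have "?z \<in> placements U E" unfolding placements_def by blast
  moreover have "core U x \<inter> core U x' \<subseteq> core U ?z" by (auto simp: core_def)
  then have "y \<in> {..<p} \<rightarrow>\<^sub>E core U ?z" using Y by (auto simp: PiE_iff)
  ultimately show ?thesis by (simp add: configs_def)
qed

text \<open>If the pair were missing, its slots could be refilled independently. By
  \<open>card_large_fibres_le\<close>, configurations with a non-edge there would be at least a
  quarter as many as those with both fibres large, and adding the pair to \<open>E\<close> would
  raise the weight.\<close>

lemma gap_can_be_added:
  assumes st: "state U E" and max: "\<And>U' E'. state U' E' \<Longrightarrow> weight U' E' \<le> weight U E"
    and gap: "(i, l) \<in> gaps" "i \<in> U" "l \<in> U"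
  shows "(i, l) \<in> E"
proof (rule ccontr)
  assume new: "(i, l) \<notin> E"
  note fin = state_finite[OF st]
  define p where "p = 2 * r * k - card U"
  let ?Z = "configs U E p"
  let ?F = "\<lambda>j. {(x, y) \<in> ?Z. card {a. (x(j := a), y) \<in> ?Z} < 4 * m\<^sup>2}"
  let ?good = "{(x, y) \<in> ?Z. 4 * m\<^sup>2 \<le> card {a. (x(i := a), y) \<in> ?Z} \<and> 4 * m\<^sup>2 \<le> card {b. (x(l := b), y) \<in> ?Z}}"
  have finZ: "finite ?Z" by (rule finite_configs[OF fin(1)])
  have g: "fst i = fst l" "snd i < snd l" "snd l < k" "\<not> H (snd i) (snd l)" "fst i \<in> {1..r}"
    using gap(1) by (auto simp: gaps_def slots_def)
  have E: "E \<subseteq> gaps" using st by (auto simp: state_def)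
  have lk: "\<not> linked i l" "\<not> linked l i" "\<not> linked i i" "\<not> linked l l"
    using g H_sym[of "snd i" "snd l"] H_irrefl by (auto simp: linked_def)
  have notE: "(l, i) \<notin> E" "(i, i) \<notin> E" "(l, l) \<notin> E" using E g by (auto simp: gaps_def)
  have good: "card ?good \<le> 4 * card {(x, y) \<in> ?Z. x i \<noteq> x l \<and> \<not> G (x i) (x l)}"
  proof (rule card_large_fibres_le[OF finZ, where V = "{..<n}"])
    show "i \<noteq> l" using g by auto
    show "(x(i := x' i), y) \<in> ?Z" if "(x, y) \<in> ?Z" "(x', y) \<in> ?Z"
      "\<And>j. j \<noteq> i \<Longrightarrow> j \<noteq> l \<Longrightarrow> x j = x' j" for x x' y
      by (rule configs_exchange[OF gap(2) lk(1,2) new notE(1) lk(3) notE(2) that])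
    show "(x(l := x' l), y) \<in> ?Z" if "(x, y) \<in> ?Z" "(x', y) \<in> ?Z"
      "\<And>j. j \<noteq> i \<Longrightarrow> j \<noteq> l \<Longrightarrow> x j = x' j" for x x' y
      by (rule configs_exchange[OF gap(3) lk(2,1) notE(1) new lk(4) notE(3) that(1,2)]) (use that(3) in blast)
    show "x i \<in> {..<n} \<and> x l \<in> {..<n}" if "(x, y) \<in> ?Z" for x y
      using that gap(2,3) by (auto simp: configs_def placements_def)
  qed (use many_nonadjacent in auto)
  have conf: "{(x, y) \<in> ?Z. x i \<noteq> x l \<and> \<not> G (x i) (x l)} = configs U (insert (i, l) E) p"
    by (auto simp: configs_def placements_def)
  have good': "card ?good \<le> 4 * count U (insert (i, l) E)"
    using good unfolding conf count_def p_def[symmetric] .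
  have "finite ?good" "finite (?F i)" "finite (?F l)" by (rule finite_subset[OF _ finZ]; blast)+
  then have "card ?Z \<le> card (?good \<union> (?F i \<union> ?F l))"
  proof (intro card_mono finite_UnI)
    show "?Z \<subseteq> ?good \<union> (?F i \<union> ?F l)"
    proof (rule subrelI)
      fix x y assume "(x, y) \<in> ?Z"
      then show "(x, y) \<in> ?good \<union> (?F i \<union> ?F l)"
        by (simp only: Un_iff mem_Collect_eq case_prod_conv not_le[symmetric]) blast
    qed
  qed
  also have "\<dots> \<le> card ?good + card (?F i \<union> ?F l)" by (rule card_Un_le)
  also have "\<dots> \<le> card ?good + (card (?F i) + card (?F l))" by (intro add_mono card_Un_le order_refl)
  finally have "count U E \<le> card ?good + (card (?F i) + card (?F l))"
    unfolding count_def p_def[symmetric] .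
  moreover have few: "8 * card (?F j) \<le> count U E" if "j \<in> U" for j
    unfolding p_def by (rule few_small_fibres[OF st _ that]) (rule max)
  \<comment> \<open>Small fibres at \<open>i\<close> and at \<open>l\<close> take at most 1/8 of the
    configurations each. A quarter of the remaining 3/4 is 3/16, which exceeds the 1/8 that
    maximality allows against the factor 8.\<close>
  ultimately have le: "3 * count U E \<le> 16 * count U (insert (i, l) E)"
    using good' few[OF gap(2)] few[OF gap(3)] by linarith
  have st': "state U (insert (i, l) E)" and st0: "state {} {}" using st gap by (auto simp: state_def)
  have "count U E * (slot_factor ^ card U * 8 ^ card E) \<ge> (8 * count U (insert (i, l) E)) * (slot_factor ^ card U * 8 ^ card E)"
    using max[OF st'] fin(2) new by (simp add: weight_def mult_ac)
  then have "8 * count U (insert (i, l) E) \<le> count U E" using slot_factor_pos by simp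
  moreover have "0 < count U E"
  proof -
    have "0 < 16 * (n ^ card U * (m ^ 3) ^ (2 * r * k - card U))" using m_ge_64 by (simp add: n_eq)
    then show ?thesis using small_cores_negligible[OF st max[OF st0]] by linarith
  qed
  ultimately show False using le by linarith
qed

section \<open>Extracting the monochromatic induced copy\<close>

text \<open>There are finitely many states, so one has maximal weight. Some colour has all its slots
  by \<open>extension_exists\<close>, its non-edges are enforced by \<open>gap_can_be_added\<close>,
  and any placement restricted to that colour is the copy.\<close>

lemma monochromatic_induced_copy:
  "\<exists>f c. induced_embedding k H n G f \<and> (\<forall>u<k. \<forall>v<k. H u v \<longrightarrow> col {f u, f v} = c)"
proof -
  let ?States = "{(U, E). state U E}"
  have "?States \<subseteq> Pow slots \<times> Pow gaps" by (auto simp: state_def)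
  then have finS: "finite ?States" by (rule finite_subset) (simp add: finite_slots finite_gaps)
  have st0: "state {} {}" by (simp add: state_def)
  let ?w = "\<lambda>(U, E). weight U E"
  have "Max (?w ` ?States) \<in> ?w ` ?States" by (rule Max_in) (use finS st0 in auto)
  then obtain U E where st: "state U E" and mx: "weight U E = Max (?w ` ?States)" by auto
  have max: "weight U' E' \<le> weight U E" if "state U' E'" for U' E'
    unfolding mx by (rule Max_ge) (use finS that in auto)
  have "\<exists>c\<in>{1..r}. \<forall>v<k. (c, v) \<in> U"
  proof (rule ccontr)
    assume "\<not> ?thesis"
    then have "\<forall>c\<in>{1..r}. \<exists>v. v < k \<and> (c, v) \<notin> U" by blast
    then obtain v where v: "\<And>c. c \<in> {1..r} \<Longrightarrow> v c < k \<and> (c, v c) \<notin> U" by metis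
    from extension_exists[OF st max[OF st0] v] obtain c where c: "c \<in> {1..r}"
      and less: "weight U E < weight (insert (c, v c) U) E" by blast
    have "state (insert (c, v c) U) E" using st c v[OF c] by (auto simp: state_def slots_def)
    from max[OF this] less show False by simp
  qed
  then obtain c where c: "c \<in> {1..r}" and full: "\<And>v. v < k \<Longrightarrow> (c, v) \<in> U" by blast
  have "0 < 16 * (n ^ card U * (m ^ 3) ^ (2 * r * k - card U))" using m_ge_64 by (simp add: n_eq)
  then have "0 < count U E" using small_cores_negligible[OF st max[OF st0]] by linarith
  then have "configs U E (2 * r * k - card U) \<noteq> {}" by (metis card.empty count_def less_irrefl)
  then obtain x where x: "x \<in> placements U E" by (auto simp: configs_def)
  define f where "f v = x (c, v)" for v
  have f_range: "f v < n" if "v < k" for v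
    using x full[OF that] by (auto simp: placements_def f_def)
  have f_edge: "mono_edge c (f u) (f v)" if "u < k" "v < k" "H u v" for u v
  proof -
    have "linked (c, u) (c, v)" using that by (simp add: linked_def)
    then show ?thesis using x full[OF that(1)] full[OF that(2)] by (force simp: placements_def f_def)
  qed
  have f_lt: "f u \<noteq> f v \<and> \<not> G (f u) (f v)" if "u < v" "v < k" "\<not> H u v" for u v
  proof -
    have "((c, u), (c, v)) \<in> gaps" using that c by (simp add: gaps_def slots_def)
    then have "((c, u), (c, v)) \<in> E" using gap_can_be_added[OF st max] full that by simp
    then show ?thesis using x by (auto simp: placements_def f_def)
  qed
  have f_gap: "f u \<noteq> f v \<and> \<not> G (f u) (f v)" if "u < k" "v < k" "u \<noteq> v" "\<not> H u v" for u v
  proof (cases "u < v")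
    case True then show ?thesis using f_lt that by simp
  next
    case False
    then have "v < u" "\<not> H v u" using that H_sym by auto
    from f_lt[OF this(1) that(1) this(2)] show ?thesis using G_sym by metis
  qed
  \<comment> \<open>Adjacent vertices have distinct images because \<open>G\<close> has no loops;
    for the others distinctness is part of the condition on pairs in \<open>E\<close>.\<close>
  have "inj_on f {0..<k}"
  proof (rule inj_onI, rule ccontr)
    fix u v assume uv: "u \<in> {0..<k}" "v \<in> {0..<k}" "f u = f v" "u \<noteq> v"
    show False
    proof (cases "H u v")
      case True
      then show False using f_edge[of u v] uv G_irrefl by (simp add: mono_edge_def)
    next
      case False
      then show False using f_gap[of u v] uv by simp
    qed
  qed
  moreover have "H u v \<longleftrightarrow> G (f u) (f v)" if "u < k" "v < k" for u v
    using f_edge[OF that] f_gap[OF that] G_irrefl H_irrefl that by (cases "u = v") (auto simp: mono_edge_def)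
  moreover have "col {f u, f v} = c" if "u < k" "v < k" "H u v" for u v
    using f_edge[OF that] by (simp add: mono_edge_def)
  ultimately have "induced_embedding k H n G f \<and> (\<forall>u<k. \<forall>v<k. H u v \<longrightarrow> col {f u, f v} = c)"
    using f_range by (auto simp: induced_embedding_def)
  then show ?thesis by blast
qed

end

section \<open>The bound\<close>

text \<open>The exponent is 21 = 7 + 8 + 6, from 128 = \<open>2 ^ 7\<close>,
  \<open>8 * r \<le> r ^ 4\<close> and \<open>8 ^ (2 * k) = 2 ^ (6 * k)\<close>. The leading 2 pays
  for rounding up to a power of two.\<close>

lemma host_size_bound:
  fixes r k :: nat
  assumes r: "2 \<le> r" and k: "1 \<le> k"
  shows "2 * (64 * (8 * r) ^ (2 * r * k) * 8 ^ (2 * k)) \<le> r ^ (21 * (r * k))"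
proof -
  have pw: "(2::nat) ^ a \<le> r ^ a" for a using r by (intro power_mono) auto
  have inc: "r ^ a \<le> r ^ b" if "a \<le> b" for a b :: nat using r that by (intro power_increasing) auto
  have rk: "1 \<le> r * k" "k \<le> r * k" using r k by (auto simp: Suc_le_eq)
  have 1: "128 \<le> r ^ (7 * (r * k))" using pw[of 7] inc[of 7 "7 * (r * k)"] rk by simp
  have "8 * r \<le> r ^ 4" using mult_le_mono1[OF pw[of 3], of r] by (simp add: power3_eq_cube power4_eq_xxxx)
  then have "(8 * r) ^ (2 * r * k) \<le> (r ^ 4) ^ (2 * r * k)" by (intro power_mono) auto
  then have 2: "(8 * r) ^ (2 * r * k) \<le> r ^ (8 * (r * k))" by (simp add: power_mult[symmetric] mult_ac)
  have "(8::nat) ^ (2 * k) = (2 ^ 3) ^ (2 * k)" by simp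
  also have "\<dots> = 2 ^ (6 * k)" by (simp only: power_mult[symmetric]) simp
  finally have 3: "8 ^ (2 * k) \<le> r ^ (6 * (r * k))"
    using pw[of "6 * k"] inc[of "6 * k" "6 * (r * k)"] rk by linarith
  have "128 * (8 * r) ^ (2 * r * k) * 8 ^ (2 * k) \<le> r ^ (7 * (r * k)) * r ^ (8 * (r * k)) * r ^ (6 * (r * k))"
    by (intro mult_le_mono 1 2 3)
  also have "\<dots> = r ^ (21 * (r * k))" by (simp only: power_add[symmetric]) (simp add: algebra_simps)
  finally show ?thesis by linarith
qed

text \<open>The host has \<open>m ^ 4\<close> vertices with
  \<open>m \<le> r ^ (21 * (r * k))\<close>, whence 84 = 4 * 21.\<close>

lemma induced_ramsey_host_exists:
  assumes r: "2 \<le> r" and k: "1 \<le> k" and H: "is_graph k H"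
  obtains n G where "is_graph n G" "ind_arrows n G r k H" "n \<le> r ^ (84 * (r * k))"
proof -
  let ?T = "64 * (8 * r) ^ (2 * r * k) * 8 ^ (2 * k)"
  have "1 \<le> ?T" using r by (simp add: Suc_le_eq)
  then obtain q0 where q0: "2 ^ q0 \<le> ?T" "?T < 2 ^ (q0 + 1)" using ex_power_ivl1[of 2 ?T] by auto
  \<comment> \<open>The least power of two above \<open>?T\<close>, hence at most
    \<open>2 * ?T\<close>.\<close>
  define m :: nat where "m = 2 ^ Suc q0"
  obtain G where G: "\<And>u v. G u v = G v u" "\<And>u. \<not> G u u"
    "\<And>A B. A \<subseteq> {..<m ^ 4} \<Longrightarrow> B \<subseteq> {..<m ^ 4} \<Longrightarrow> 4 * m\<^sup>2 \<le> card A \<Longrightarrow>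
      4 * m\<^sup>2 \<le> card B \<Longrightarrow> card A * card B \<le> 4 * card {(a, b) \<in> A \<times> B. G a b}"
    "\<And>A B. A \<subseteq> {..<m ^ 4} \<Longrightarrow> B \<subseteq> {..<m ^ 4} \<Longrightarrow> 4 * m\<^sup>2 \<le> card A \<Longrightarrow>
      4 * m\<^sup>2 \<le> card B \<Longrightarrow> card A * card B \<le> 4 * card {(a, b) \<in> A \<times> B. a \<noteq> b \<and> \<not> G a b}"
    by (rule balanced_graph_exists[of "Suc q0", folded m_def]) (simp, rule that)
  have "m \<le> 2 * ?T" using mult_le_mono2[OF q0(1), of 2] by (simp only: m_def power_Suc)
  also have "\<dots> \<le> r ^ (21 * (r * k))" by (rule host_size_bound[OF r k])
  finally have "m ^ 4 \<le> (r ^ (21 * (r * k))) ^ 4" by (rule power_mono) simp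
  also have "\<dots> = r ^ (84 * (r * k))" by (simp add: power_mult[symmetric] mult_ac)
  finally have size: "m ^ 4 \<le> r ^ (84 * (r * k))" .
  have mT: "?T \<le> m" using q0(2) by (simp add: m_def)
  have "ind_arrows (m ^ 4) G r k H"
    unfolding ind_arrows_def
  proof (intro allI impI)
    fix c :: "nat set \<Rightarrow> nat"
    assume c: "\<forall>u<m ^ 4. \<forall>v<m ^ 4. G u v \<longrightarrow> c {u, v} \<in> {1..r}"
    interpret coloured_host "m ^ 4" m r k G H c
      by unfold_locales (use r k mT G H c in \<open>auto simp: is_graph_def\<close>)
    show "\<exists>f col. induced_embedding k H (m ^ 4) G f \<and> (\<forall>u<k. \<forall>v<k. H u v \<longrightarrow> c {f u, f v} = col)"
      by (rule monochromatic_induced_copy)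
  qed
  moreover have "is_graph (m ^ 4) G" using G(1,2) by (simp add: is_graph_def)
  ultimately show ?thesis using that size by blast
qed

theorem theorem1p2:
  "\<exists>C::real. C > 0 \<and>
     (\<forall>(r::nat) (k::nat) (H::nat \<Rightarrow> nat \<Rightarrow> bool). r \<ge> 2 \<longrightarrow> is_graph k H \<longrightarrow>
        (\<exists>n G. is_graph n G \<and> ind_arrows n G r k H) \<and>
        real (R_ind k H r) \<le> real r powr (C * real r * real k))"
proof (rule exI[of _ 84], intro conjI allI impI)
  fix r k :: nat and H :: "nat \<Rightarrow> nat \<Rightarrow> bool"
  assume r: "2 \<le> r" and H: "is_graph k H"
  obtain n G where n: "is_graph n G" "ind_arrows n G r k H" "n \<le> r ^ (84 * (r * k))"
  proof (cases "k = 0")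
    \<comment> \<open>The host construction assumes \<open>1 \<le> k\<close>; for
      \<open>k = 0\<close> the host without vertices works.\<close>
    case True
    have "is_graph 0 (\<lambda>_ _. False)" "ind_arrows 0 (\<lambda>_ _. False) r k H"
      by (simp_all add: is_graph_def ind_arrows_def induced_embedding_def True)
    then show ?thesis using that by blast
  next
    case False
    then show ?thesis using induced_ramsey_host_exists[OF r _ H] that by (metis One_nat_def Suc_leI gr0I)
  qed
  \<comment> \<open>\<open>R_ind\<close> is a \<open>LEAST\<close>, hence informative only once a
    host is known to exist.\<close>
  then show "\<exists>n G. is_graph n G \<and> ind_arrows n G r k H" by blast
  have "R_ind k H r \<le> n" unfolding R_ind_def by (rule Least_le) (use n in blast)
  then have "real (R_ind k H r) \<le> real (r ^ (84 * (r * k)))" using n(3) by (simp only: of_nat_le_iff)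
  also have "\<dots> = real r powr real (84 * (r * k))"
    unfolding of_nat_power by (rule powr_realpow[symmetric]) (use r in simp)
  finally show "real (R_ind k H r) \<le> real r powr (84 * real r * real k)" by (simp add: mult.assoc)
qed simp

end
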